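(* Let $E$ be a real locally convex topological vector space with topological dual $E^*$, and let $T:E\rightrightarrows E^*$ be a set-valued map. The following are equivalent: (1) $T$ is monotone, that is: for every finite subset $\{(x_i,x_i^* ) : i\in\{1,\dots,m\}\}\subset T$, $$\forall i,j\in\{1,\dots,m\},\quad \langle x_i^*-x_j^*,\,x_i-x_j\rangle\ge 0.$$ (2) For every $x^*\in E^*$ and every finite subset $\{(x_i,x_i^* ) : i\in\{1,\dots,m\}\}\subset T$, $$\exists \bar x\in[x_1,\ldots,x_m]\ \text{such that}\ \forall i\in\{1,\dots,m\},\quad \langle x_i^*-x^*,\,x_i-\bar x\rangle\ge 0.$$ (3) For every $x^*\in E^*$ and every nonempty compact convex subset $K\subset E$, $$\exists \bar x\in K\ \text{such that}\ \forall (y,y^* )\in T\cap(K\times E^* ),\quad \langle y^*-x^*,\,y-\bar x\rangle\ge 0.$$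
   Context: A set-valued map $T:E\rightrightarrows E^*$ assigns to each $x\in E$ a (possibly empty) subset $T(x)\subset E^*$, and is identified with its graph $T\subset E\times E^*$, so that $(x,x^* )\in T$ means $x^*\in T(x)$. The duality pairing between $E^*$ and $E$ is denoted $\langle\cdot,\cdot\rangle$. $[x_1,\ldots,x_m]$ denotes the closed convex hull of $\{x_1,\ldots,x_m\}$. Here $m$ is a positive integer. $T$ is monotone if $\langle y^*-x^*,y-x\rangle\ge 0$ for all $(x,x^* )\in T$ and $(y,y^* )\in T$. *)

theory Defs
  imports "HOL-Analysis.Analysis"
begin

(* As usual in HOL, the space is a whole type. The topology is not assumed to be Hausdorff. *)

class topological_real_vector = real_vector + topological_ab_group_add +
  assumes tendsto_scaleR_Pair:
    "LIM p (nhds c \<times>\<^sub>F nhds a). fst p *\<^sub>R snd p :> nhds (c *\<^sub>R a)"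

(* The convexity of V is written out because the constant convex cannot be used inside
   a class specification; see the lemma below. *)
class locally_convex_space = topological_real_vector +
  assumes locally_convex_nhds_0:
    "open U \<Longrightarrow> 0 \<in> U \<Longrightarrow> \<exists>V. open V \<and> 0 \<in> V \<and> V \<subseteq> U \<and>
      (\<forall>x\<in>V. \<forall>y\<in>V. \<forall>u\<ge>0. \<forall>v\<ge>0. u + v = 1 \<longrightarrow> u *\<^sub>R x + v *\<^sub>R y \<in> V)"

lemma locally_convex_nhds_0_convex:
  fixes U :: "'a::locally_convex_space set"
  assumes "open U" "0 \<in> U"
  obtains V where "open V" "0 \<in> V" "V \<subseteq> U" "convex V"
  using locally_convex_nhds_0[OF assms] unfolding convex_def by blast

instance real_normed_vector \<subseteq> locally_convex_space
proof
  fix c :: real and a :: 'a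
  have "((\<lambda>p. fst p *\<^sub>R snd p) \<longlongrightarrow> c *\<^sub>R a) (nhds c \<times>\<^sub>F nhds a)"
    by (intro tendsto_scaleR filterlim_fst filterlim_snd)
  then show "LIM p (nhds c \<times>\<^sub>F nhds a). fst p *\<^sub>R snd p :> nhds (c *\<^sub>R a)" .
next
  fix U :: "'a set"
  assume "open U" "0 \<in> U"
  then obtain e where "e > 0" "ball 0 e \<subseteq> U"
    by (meson openE)
  then show "\<exists>V. open V \<and> 0 \<in> V \<and> V \<subseteq> U \<and>
      (\<forall>x\<in>V. \<forall>y\<in>V. \<forall>u\<ge>0. \<forall>v\<ge>0. u + v = 1 \<longrightarrow> u *\<^sub>R x + v *\<^sub>R y \<in> V)"
    using convex_ball[of "0::'a" e] unfolding convex_def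
    by (intro exI[of _ "ball 0 e"]) simp
qed

(* Elements of the dual are functions, with pointwise subtraction; the duality pairing of
   a functional f with a vector x is the application f x. *)

definition topological_dual :: "('a::topological_real_vector \<Rightarrow> real) set" where
  "topological_dual = {f. linear f \<and> continuous_on UNIV f}"

definition graph_of :: "('a \<Rightarrow> 'b set) \<Rightarrow> ('a \<times> 'b) set" where
  "graph_of T = {(x, y). y \<in> T x}"

definition monotone_operator :: "('a::topological_real_vector \<Rightarrow> ('a \<Rightarrow> real) set) \<Rightarrow> bool" where
  "monotone_operator T \<longleftrightarrow>
    (\<forall>(x, f)\<in>graph_of T. \<forall>(y, g)\<in>graph_of T. (g - f) (y - x) \<ge> 0)"

definition closed_convex_hull :: "'a::topological_real_vector set \<Rightarrow> 'a set" where
  "closed_convex_hull S = (\<lambda>C. closed C \<and> convex C) hull S"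

end

theory Submission
  imports Defs
begin

text \<open>
  The pairwise condition on finite families is monotonicity for the family's own pairs. That
  monotonicity implies the two existence conditions rests on a finite Debrunner--Flor type
  argument. Let \<open>K\<close> be compact and convex, let
  \<open>(y\<^sub>i, h\<^sub>i)\<close> be finitely many monotonically related pairs with \<open>y\<^sub>i \<in> K\<close>, and let \<open>g\<close> be in the dual.
  The violations \<open>r\<^sub>i(z) = max 0 (- (h\<^sub>i - g) (y\<^sub>i - z))\<close> are continuous in \<open>z\<close>, so
  \<open>\<Sum> r\<^sub>i(z)\<^sup>2\<close> attains its minimum over \<open>K\<close> at some \<open>z\<close>. Moving from \<open>z\<close> towards \<open>y\<^sub>j\<close> cannot
  decrease this sum, and the first-order condition reads
  \<open>\<Sum>\<^sub>i r\<^sub>i (h\<^sub>i - g) (y\<^sub>i - y\<^sub>j) + \<Sum>\<^sub>i r\<^sub>i\<^sup>2 \<le> 0\<close>. Weighting it by \<open>r\<^sub>j\<close> and summing over \<open>j\<close> makes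
  the first term a quadratic form whose symmetric part has the entries
  \<open>(h\<^sub>i - h\<^sub>j) (y\<^sub>i - y\<^sub>j) / 2 \<ge> 0\<close>. Hence all \<open>r\<^sub>i\<close> vanish, and \<open>z\<close> satisfies every inequality
  (\<open>ex_solution_finite\<close>).

  Taking for \<open>K\<close> the convex hull of finitely many points, which is compact, gives the existence
  condition for finite families. For an arbitrary compact convex \<open>K\<close>, each inequality cuts out
  a closed set of \<open>z\<close>, and compactness of \<open>K\<close> passes from finitely many inequalities to all of them.

  Conversely, test either existence condition on two pairs \<open>(x, f)\<close>, \<open>(y, h)\<close> with the
  midpoint \<open>g = (f + h) / 2\<close>: the two inequalities add up to \<open>(h - f) (y - x) / 2 \<ge> 0\<close>,
  because \<open>z\<close> cancels (\<open>monotone_operator_if_midpoint_solvable\<close>).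
\<close>

section \<open>Topological vector spaces and their duals\<close>

lemma continuous_on_scaleR_tvs:
  fixes f :: "'b::topological_space \<Rightarrow> real" and h :: "'b \<Rightarrow> 'a::topological_real_vector"
  assumes "continuous_on S f" "continuous_on S h"
  shows "continuous_on S (\<lambda>x. f x *\<^sub>R h x)"
  unfolding continuous_on_def
proof
  fix x assume x: "x \<in> S"
  have "LIM w at x within S. (f w, h w) :> nhds (f x) \<times>\<^sub>F nhds (h x)"
    using assms x unfolding continuous_on_def by (intro filterlim_Pair) auto
  from filterlim_compose[OF tendsto_scaleR_Pair this]
  show "((\<lambda>x. f x *\<^sub>R h x) \<longlongrightarrow> f x *\<^sub>R h x) (at x within S)" by simp
qed

text \<open>
  Induction on the finite set: the hull of \<open>insert a S\<close> is the image of
  \<open>[0,1] \<times> convex hull S\<close> under the continuous map \<open>(u, b) \<mapsto> u a + (1 - u) b\<close>.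
\<close>
lemma compact_convex_hull_finite:
  fixes S :: "'a::topological_real_vector set"
  assumes "finite S"
  shows "compact (convex hull S)"
  using assms
proof induction
  case (insert a S)
  show ?case
  proof (cases "S = {}")
    case False
    have "convex hull (insert a S)
        = (\<lambda>p. fst p *\<^sub>R a + (1 - fst p) *\<^sub>R snd p) ` ({0..1} \<times> (convex hull S))" (is "_ = ?F ` ?D")
    proof (intro equalityI subsetI)
      fix w assume "w \<in> convex hull (insert a S)"
      then obtain u v b where *: "u \<ge> 0" "v \<ge> 0" "u + v = 1" "b \<in> convex hull S"
          "w = u *\<^sub>R a + v *\<^sub>R b"
        unfolding convex_hull_insert[OF False] by auto
      then have "v = 1 - u" by simp
      with * show "w \<in> ?F ` ?D" by (intro image_eqI[of _ _ "(u, b)"]) auto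
    next
      fix w assume "w \<in> ?F ` ?D"
      then obtain u b where "0 \<le> u" "u \<le> 1" "b \<in> convex hull S" "w = u *\<^sub>R a + (1 - u) *\<^sub>R b"
        by auto
      then show "w \<in> convex hull (insert a S)"
        unfolding convex_hull_insert[OF False]
        by (intro CollectI exI[of _ u] exI[of _ "1 - u"] exI[of _ b] conjI) auto
    qed
    moreover have "continuous_on ?D ?F"
      by (intro continuous_intros continuous_on_scaleR_tvs)
    ultimately show ?thesis
      using compact_continuous_image[of ?D ?F] compact_Times[OF compact_Icc insert.IH] by simp
  qed simp
qed simp

lemma convex_hull_subset_closed_convex_hull: "convex hull S \<subseteq> closed_convex_hull S"
  unfolding closed_convex_hull_def by (intro hull_antimono) auto

lemma topological_dual_diff:
  assumes "f \<in> topological_dual" "g \<in> topological_dual"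
  shows "f - g \<in> topological_dual"
proof -
  have "linear (\<lambda>x. f x - g x)" "continuous_on UNIV (\<lambda>x. f x - g x)"
    using assms unfolding topological_dual_def
    by (auto intro: linear_compose_sub continuous_on_diff)
  then show ?thesis unfolding topological_dual_def fun_diff_def by simp
qed

lemma topological_dual_midpoint:
  assumes "f \<in> topological_dual" "g \<in> topological_dual"
  shows "(\<lambda>x. (f x + g x) / 2) \<in> topological_dual"
proof -
  have "linear (\<lambda>x. (1/2) *\<^sub>R (f x + g x))"
    using assms unfolding topological_dual_def
    by (intro linear_compose_scale_right linear_compose_add) auto
  moreover have "continuous_on UNIV (\<lambda>x. (f x + g x) / 2)"
    using assms unfolding topological_dual_def by (auto intro!: continuous_intros)
  ultimately show ?thesis unfolding topological_dual_def by simp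
qed

lemma continuous_on_dual_affine:
  assumes "f \<in> topological_dual"
  shows "continuous_on S (\<lambda>z. f (y - z))"
  using assms unfolding topological_dual_def
  by (intro continuous_on_compose2[of UNIV f S]) (auto intro: continuous_intros)

section \<open>Finitely many inequalities\<close>

text \<open>
  First-order condition: replacing \<open>max 0 (a i + t * b i)\<close> by the larger
  \<open>\<bar>max 0 (a i) + t * b i\<bar>\<close> turns the right-hand side into a polynomial in \<open>t\<close>
  with the same value at \<open>0\<close>, whose linear coefficient must then be nonnegative.
\<close>
lemma first_variation_sum_pos_part_squares:
  fixes a b :: "'i \<Rightarrow> real"
  assumes min: "\<And>t. 0 < t \<Longrightarrow> t \<le> 1 \<Longrightarrow>
    (\<Sum>i\<in>I. (max 0 (a i))\<^sup>2) \<le> (\<Sum>i\<in>I. (max 0 (a i + t * b i))\<^sup>2)"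
  shows "0 \<le> (\<Sum>i\<in>I. max 0 (a i) * b i)"
proof -
  let ?L = "\<Sum>i\<in>I. max 0 (a i) * b i" and ?Q = "\<Sum>i\<in>I. (b i)\<^sup>2"
  have slope: "0 \<le> 2 * ?L + t * ?Q" if t: "0 < t" "t \<le> 1" for t
  proof -
    have "(max 0 (a i + t * b i))\<^sup>2 \<le> (max 0 (a i) + t * b i)\<^sup>2" for i
    proof (cases "a i + t * b i \<le> 0")
      case False
      then show ?thesis by (intro power_mono) auto
    qed simp
    then have "(\<Sum>i\<in>I. (max 0 (a i))\<^sup>2) \<le> (\<Sum>i\<in>I. (max 0 (a i) + t * b i)\<^sup>2)"
      using min[OF t] by (meson order_trans sum_mono)
    also have "\<dots> = (\<Sum>i\<in>I. (max 0 (a i))\<^sup>2 + 2 * t * (max 0 (a i) * b i) + t\<^sup>2 * (b i)\<^sup>2)"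
      by (intro sum.cong) (auto simp: power2_eq_square algebra_simps)
    also have "\<dots> = (\<Sum>i\<in>I. (max 0 (a i))\<^sup>2) + 2 * t * ?L + t\<^sup>2 * ?Q"
      by (simp only: sum.distrib sum_distrib_left)
    also have "\<dots> = (\<Sum>i\<in>I. (max 0 (a i))\<^sup>2) + t * (2 * ?L + t * ?Q)"
      by (simp add: power2_eq_square distrib_left)
    finally show ?thesis using t by (simp add: zero_le_mult_iff)
  qed
  have "((\<lambda>t. 2 * ?L + t * ?Q) \<longlongrightarrow> 2 * ?L + 0 * ?Q) (at_right 0)"
    by (intro tendsto_intros)
  moreover have "\<forall>\<^sub>F t in at_right 0. 0 \<le> 2 * ?L + t * ?Q"
    using slope by (auto simp: eventually_at_right_field intro!: exI[of _ 1])
  ultimately have "0 \<le> 2 * ?L + 0 * ?Q"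
    by (intro tendsto_lowerbound[of _ _ "at_right 0"]) auto
  then show ?thesis by simp
qed

text \<open>
  The symmetric part of \<open>A\<close> has nonnegative entries, so the quadratic form of \<open>A\<close> is nonnegative at
  nonnegative vectors.
\<close>
lemma quadratic_form_nonneg:
  fixes A :: "'i \<Rightarrow> 'i \<Rightarrow> real"
  assumes "\<And>i j. i \<in> I \<Longrightarrow> j \<in> I \<Longrightarrow> 0 \<le> A i j + A j i" and "\<And>i. i \<in> I \<Longrightarrow> 0 \<le> r i"
  shows "0 \<le> (\<Sum>j\<in>I. \<Sum>i\<in>I. r j * r i * A i j)"
proof -
  let ?S = "\<Sum>j\<in>I. \<Sum>i\<in>I. r j * r i * A i j"
  have "?S = (\<Sum>j\<in>I. \<Sum>i\<in>I. r j * r i * A j i)"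
    by (subst sum.swap) (simp add: mult.commute)
  then have "2 * ?S = (\<Sum>j\<in>I. \<Sum>i\<in>I. r j * r i * (A i j + A j i))"
    by (simp add: distrib_left sum.distrib)
  also have "\<dots> \<ge> 0"
    using assms by (intro sum_nonneg mult_nonneg_nonneg) auto
  finally show ?thesis by simp
qed

text \<open>
  A minimiser over \<open>K\<close> of the sum of the squared violations violates none of the inequalities.
\<close>
lemma ex_solution_finite:
  fixes y :: "'i \<Rightarrow> 'a::topological_real_vector" and h :: "'i \<Rightarrow> 'a \<Rightarrow> real"
  assumes fin: "finite I" and K: "compact K" "convex K" "K \<noteq> {}"
    and y: "\<And>i. i \<in> I \<Longrightarrow> y i \<in> K" and h: "\<And>i. i \<in> I \<Longrightarrow> h i \<in> topological_dual"
    and g: "g \<in> topological_dual"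
    and mono: "\<And>i j. i \<in> I \<Longrightarrow> j \<in> I \<Longrightarrow> 0 \<le> (h i - h j) (y i - y j)"
  shows "\<exists>z\<in>K. \<forall>i\<in>I. 0 \<le> (h i - g) (y i - z)"
proof -
  define d where "d i = h i - g" for i
  have d: "d i \<in> topological_dual" if "i \<in> I" for i
    using h[OF that] g unfolding d_def by (rule topological_dual_diff)
  then have lin: "linear (d i)" if "i \<in> I" for i
    using that unfolding topological_dual_def by simp
  define v where "v z i = max 0 (- d i (y i - z))" for z i
  have "continuous_on K (\<lambda>z. \<Sum>i\<in>I. (v z i)\<^sup>2)"
    unfolding v_def using d
    by (intro continuous_intros continuous_on_max continuous_on_dual_affine) auto
  then obtain z where z: "z \<in> K" and min: "\<And>w. w \<in> K \<Longrightarrow> (\<Sum>i\<in>I. (v z i)\<^sup>2) \<le> (\<Sum>i\<in>I. (v w i)\<^sup>2)"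
    using continuous_attains_inf[OF K(1,3)] by blast
  define r where "r = v z"
  have r_nonneg: "0 \<le> r i" for i unfolding r_def v_def by simp
  define R where "R = (\<Sum>i\<in>I. (r i)\<^sup>2)"
  have first_order: "(\<Sum>i\<in>I. r i * d i (y i - y j)) + R \<le> 0" if j: "j \<in> I" for j
  proof -
    have "0 \<le> (\<Sum>i\<in>I. max 0 (- d i (y i - z)) * d i (y j - z))"
    proof (rule first_variation_sum_pos_part_squares)
      fix t :: real assume t: "0 < t" "t \<le> 1"
      have "(1 - t) *\<^sub>R z + t *\<^sub>R y j \<in> K"
        using K(2) z y[OF j] t by (intro convexD) auto
      moreover have "v ((1 - t) *\<^sub>R z + t *\<^sub>R y j) i = max 0 (- d i (y i - z) + t * d i (y j - z))"
        if "i \<in> I" for i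
        unfolding v_def using lin[OF that]
        by (simp add: linear_diff linear_add linear_scale algebra_simps)
      ultimately show "(\<Sum>i\<in>I. (max 0 (- d i (y i - z)))\<^sup>2)
          \<le> (\<Sum>i\<in>I. (max 0 (- d i (y i - z) + t * d i (y j - z)))\<^sup>2)"
        using min[of "(1 - t) *\<^sub>R z + t *\<^sub>R y j"] by (simp add: v_def)
    qed
    also have "\<dots> = (\<Sum>i\<in>I. - (r i * d i (y i - y j)) - (r i)\<^sup>2)"
    proof (rule sum.cong)
      fix i assume i: "i \<in> I"
      have "d i (y j - z) = - d i (y i - y j) + d i (y i - z)"
        using lin[OF i] by (simp add: linear_diff)
      then have "r i * d i (y j - z) = - (r i * d i (y i - y j)) + r i * d i (y i - z)"
        by (simp only: distrib_left mult_minus_right)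
      moreover have "r i * d i (y i - z) = - (r i)\<^sup>2"
        by (auto simp: r_def v_def max_def power2_eq_square)
      moreover have "max 0 (- d i (y i - z)) = r i" by (simp add: r_def v_def)
      ultimately show "max 0 (- d i (y i - z)) * d i (y j - z)
          = - (r i * d i (y i - y j)) - (r i)\<^sup>2"
        by (simp only:)
    qed simp
    finally show ?thesis by (simp add: R_def sum_subtractf sum_negf)
  qed
  have "(\<Sum>j\<in>I. r j * ((\<Sum>i\<in>I. r i * d i (y i - y j)) + R)) \<le> 0"
    using first_order r_nonneg by (intro sum_nonpos mult_nonneg_nonpos) auto
  moreover have "(\<Sum>j\<in>I. r j * ((\<Sum>i\<in>I. r i * d i (y i - y j)) + R))
      = (\<Sum>j\<in>I. \<Sum>i\<in>I. r j * r i * d i (y i - y j)) + sum r I * R"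
    by (simp add: distrib_left sum.distrib sum_distrib_left sum_distrib_right mult.assoc)
  moreover have "0 \<le> (\<Sum>j\<in>I. \<Sum>i\<in>I. r j * r i * d i (y i - y j))"
  proof (rule quadratic_form_nonneg)
    fix i j assume ij: "i \<in> I" "j \<in> I"
    \<comment> \<open>The functional \<open>g\<close> cancels.\<close>
    have "d i (y i - y j) + d j (y j - y i) = (h i - h j) (y i - y j)"
      using linear_neg[OF lin[OF ij(2)], of "y i - y j"] by (simp add: d_def)
    then show "0 \<le> d i (y i - y j) + d j (y j - y i)" using mono[OF ij] by simp
  qed (rule r_nonneg)
  ultimately have "sum r I * R \<le> 0" by simp
  moreover have "0 \<le> sum r I" "0 \<le> R"
    using r_nonneg unfolding R_def by (auto intro: sum_nonneg)
  ultimately have "sum r I = 0 \<or> R = 0"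
    using mult_pos_pos[of "sum r I" R] by linarith
  then have "r i = 0" if "i \<in> I" for i
    using that fin r_nonneg unfolding R_def by (auto simp: sum_nonneg_eq_0_iff)
  then have "\<forall>i\<in>I. 0 \<le> (h i - g) (y i - z)"
    unfolding r_def v_def d_def by (fastforce simp: max_def split: if_splits)
  with z show ?thesis by blast
qed

section \<open>The characterisations of monotonicity\<close>

lemma monotone_operatorD:
  assumes "monotone_operator T" "(x, f) \<in> graph_of T" "(y, h) \<in> graph_of T"
  shows "0 \<le> (h - f) (y - x)"
  using assms unfolding monotone_operator_def by fast

lemma graph_of_dual:
  assumes "\<And>x. T x \<subseteq> topological_dual" "(x, f) \<in> graph_of T"
  shows "f \<in> topological_dual"
  using assms unfolding graph_of_def by blast

text \<open>
  For the midpoint functional \<open>g\<close> the point \<open>z\<close> drops out of the sum of the two inequalities, so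
  solvability for two pairs at a time, without control of \<open>z\<close>, already forces monotonicity.
\<close>
lemma monotone_operator_if_midpoint_solvable:
  assumes T: "\<And>x. T x \<subseteq> topological_dual"
    and solv: "\<And>x f y h g. (x, f) \<in> graph_of T \<Longrightarrow> (y, h) \<in> graph_of T \<Longrightarrow> g \<in> topological_dual
      \<Longrightarrow> \<exists>z. 0 \<le> (f - g) (x - z) \<and> 0 \<le> (h - g) (y - z)"
  shows "monotone_operator T"
proof -
  have "0 \<le> (h - f) (y - x)" if xf: "(x, f) \<in> graph_of T" and yh: "(y, h) \<in> graph_of T" for x f y h
  proof -
    note f = graph_of_dual[OF T xf] and h = graph_of_dual[OF T yh]
    obtain z where "0 \<le> f (x - z) - (f (x - z) + h (x - z)) / 2"
        "0 \<le> h (y - z) - (f (y - z) + h (y - z)) / 2"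
      using solv[OF xf yh topological_dual_midpoint[OF f h]] by auto
    then have "0 \<le> (h (y - z) - f (y - z)) - (h (x - z) - f (x - z))"
      by (simp add: field_simps)
    also have "\<dots> = (h - f) (y - x)"
      using f h unfolding topological_dual_def by (simp add: linear_diff)
    finally show ?thesis .
  qed
  then show ?thesis unfolding monotone_operator_def by blast
qed

lemma monotone_operator_iff_families:
  "monotone_operator T \<longleftrightarrow>
    (\<forall>(m::nat) (x :: nat \<Rightarrow> 'a::topological_real_vector) (f :: nat \<Rightarrow> 'a \<Rightarrow> real).
       m \<ge> 1 \<and> {(x i, f i) | i. i \<in> {1..m}} \<subseteq> graph_of T \<longrightarrow>
       (\<forall>i\<in>{1..m}. \<forall>j\<in>{1..m}. (f i - f j) (x i - x j) \<ge> 0))" (is "_ \<longleftrightarrow> ?R")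
proof
  assume mono: "monotone_operator T"
  show ?R
  proof (intro allI impI ballI)
    fix m i j :: nat and x and f :: "nat \<Rightarrow> 'a \<Rightarrow> real"
    assume "m \<ge> 1 \<and> {(x i, f i) | i. i \<in> {1..m}} \<subseteq> graph_of T" "i \<in> {1..m}" "j \<in> {1..m}"
    then have "(x i, f i) \<in> graph_of T" "(x j, f j) \<in> graph_of T" by blast+
    then show "(f i - f j) (x i - x j) \<ge> 0" using monotone_operatorD[OF mono] by blast
  qed
next
  assume R: ?R
  have "0 \<le> (h - f) (y - x)" if "(x, f) \<in> graph_of T" "(y, h) \<in> graph_of T" for x f y h
  proof -
    let ?x = "\<lambda>i::nat. if i = 1 then x else y" and ?f = "\<lambda>i::nat. if i = 1 then f else h"
    have "{(?x i, ?f i) | i. i \<in> {1..2}} \<subseteq> graph_of T" using that by auto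
    then have "(?f 2 - ?f 1) (?x 2 - ?x 1) \<ge> 0" by (intro R[rule_format, of 2]) auto
    then show ?thesis by simp
  qed
  then show "monotone_operator T" unfolding monotone_operator_def by blast
qed

lemma monotone_operator_iff_finite_solvable:
  fixes T :: "'a::topological_real_vector \<Rightarrow> ('a \<Rightarrow> real) set"
  assumes T: "\<And>x. T x \<subseteq> topological_dual"
  shows "monotone_operator T \<longleftrightarrow>
    (\<forall>g\<in>topological_dual. \<forall>(m::nat) (x :: nat \<Rightarrow> 'a) (f :: nat \<Rightarrow> 'a \<Rightarrow> real).
       m \<ge> 1 \<and> {(x i, f i) | i. i \<in> {1..m}} \<subseteq> graph_of T \<longrightarrow>
       (\<exists>z\<in>closed_convex_hull {x i | i. i \<in> {1..m}}.
          \<forall>i\<in>{1..m}. (f i - g) (x i - z) \<ge> 0))" (is "_ \<longleftrightarrow> ?R")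
proof
  assume mono: "monotone_operator T"
  show ?R
  proof (intro ballI allI impI)
    fix g :: "'a \<Rightarrow> real" and m :: nat and x :: "nat \<Rightarrow> 'a" and f :: "nat \<Rightarrow> 'a \<Rightarrow> real"
    assume g: "g \<in> topological_dual"
      and m: "m \<ge> 1 \<and> {(x i, f i) | i. i \<in> {1..m}} \<subseteq> graph_of T"
    let ?X = "{x i | i. i \<in> {1..m}}"
    have X: "?X = x ` {1..m}" by blast
    have gr: "(x i, f i) \<in> graph_of T" if "i \<in> {1..m}" for i using m that by blast
    have "\<exists>z\<in>convex hull ?X. \<forall>i\<in>{1..m}. 0 \<le> (f i - g) (x i - z)"
    proof (rule ex_solution_finite)
      show "compact (convex hull ?X)" unfolding X by (intro compact_convex_hull_finite) simp
      show "convex hull ?X \<noteq> {}" unfolding X using m by simp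
      show "x i \<in> convex hull ?X" if "i \<in> {1..m}" for i
        unfolding X using that by (intro hull_inc) simp
      show "f i \<in> topological_dual" if "i \<in> {1..m}" for i
        using graph_of_dual[OF T gr[OF that]] .
      show "0 \<le> (f i - f j) (x i - x j)" if "i \<in> {1..m}" "j \<in> {1..m}" for i j
        using monotone_operatorD[OF mono gr[OF that(2)] gr[OF that(1)]] .
    qed (use g in auto)
    then show "\<exists>z\<in>closed_convex_hull ?X. \<forall>i\<in>{1..m}. (f i - g) (x i - z) \<ge> 0"
      using convex_hull_subset_closed_convex_hull by blast
  qed
next
  assume R: ?R
  show "monotone_operator T"
  proof (rule monotone_operator_if_midpoint_solvable[OF T])
    fix x f y h and g :: "'a \<Rightarrow> real"
    assume xf: "(x, f) \<in> graph_of T" and yh: "(y, h) \<in> graph_of T" and g: "g \<in> topological_dual"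
    let ?x = "\<lambda>i::nat. if i = 1 then x else y" and ?f = "\<lambda>i::nat. if i = 1 then f else h"
    have "{(?x i, ?f i) | i. i \<in> {1..2}} \<subseteq> graph_of T" using xf yh by auto
    then have "\<exists>z\<in>closed_convex_hull {?x i | i. i \<in> {1..2}}.
        \<forall>i\<in>{1..2}. (?f i - g) (?x i - z) \<ge> 0"
      using bspec[OF R g, THEN spec, THEN spec, THEN spec, THEN mp, of 2 ?x ?f] by simp
    then obtain z where z: "\<And>i. i \<in> {1..2} \<Longrightarrow> (?f i - g) (?x i - z) \<ge> 0" by blast
    from z[of 1] z[of 2] show "\<exists>z. 0 \<le> (f - g) (x - z) \<and> 0 \<le> (h - g) (y - z)"
      by auto
  qed
qed

lemma monotone_operator_iff_compact_solvable:
  fixes T :: "'a::topological_real_vector \<Rightarrow> ('a \<Rightarrow> real) set"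
  assumes T: "\<And>x. T x \<subseteq> topological_dual"
  shows "monotone_operator T \<longleftrightarrow>
    (\<forall>g\<in>topological_dual. \<forall>K :: 'a set. K \<noteq> {} \<and> compact K \<and> convex K \<longrightarrow>
       (\<exists>z\<in>K. \<forall>(y, h)\<in>graph_of T \<inter> (K \<times> topological_dual). (h - g) (y - z) \<ge> 0))"
    (is "_ \<longleftrightarrow> ?R")
proof
  assume mono: "monotone_operator T"
  show ?R
  proof (intro ballI allI impI)
    fix g :: "'a \<Rightarrow> real" and K :: "'a set"
    assume g: "g \<in> topological_dual" and K: "K \<noteq> {} \<and> compact K \<and> convex K"
    let ?P = "graph_of T \<inter> (K \<times> topological_dual)"
    let ?C = "\<lambda>p. {z. 0 \<le> (snd p - g) (fst p - z)}"
    have "K \<inter> (\<Inter>p\<in>?P. ?C p) \<noteq> {}"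
    proof (rule compact_imp_fip_image)
      show "compact K" using K by simp
      show "closed (?C p)" if "p \<in> ?P" for p
      proof (rule closed_Collect_le)
        show "continuous_on UNIV (\<lambda>z. (snd p - g) (fst p - z))"
          using that g by (intro continuous_on_dual_affine topological_dual_diff) auto
      qed simp
      fix F assume F: "finite F" "F \<subseteq> ?P"
      have "\<exists>z\<in>K. \<forall>p\<in>F. 0 \<le> (snd p - g) (fst p - z)"
      proof (rule ex_solution_finite)
        fix p q assume "p \<in> F" "q \<in> F"
        then show "0 \<le> (snd p - snd q) (fst p - fst q)"
          using F by (intro monotone_operatorD[OF mono]) auto
      qed (use F K g in auto)
      then show "K \<inter> (\<Inter>p\<in>F. ?C p) \<noteq> {}" by blast
    qed
    then obtain z where "z \<in> K" "\<forall>p\<in>?P. 0 \<le> (snd p - g) (fst p - z)" by blast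
    then show "\<exists>z\<in>K. \<forall>(y, h)\<in>?P. (h - g) (y - z) \<ge> 0"
      by (intro bexI[of _ z]) (simp_all add: case_prod_beta)
  qed
next
  assume R: ?R
  show "monotone_operator T"
  proof (rule monotone_operator_if_midpoint_solvable[OF T])
    fix x f y h and g :: "'a \<Rightarrow> real"
    assume xf: "(x, f) \<in> graph_of T" and yh: "(y, h) \<in> graph_of T" and g: "g \<in> topological_dual"
    let ?K = "convex hull {x, y}"
    have "compact ?K" by (intro compact_convex_hull_finite) simp
    then obtain z where "\<forall>(y, h)\<in>graph_of T \<inter> (?K \<times> topological_dual). (h - g) (y - z) \<ge> 0"
      using R[rule_format, OF g, of ?K] by auto
    moreover have "x \<in> ?K" "y \<in> ?K" by (auto intro: hull_inc)
    ultimately show "\<exists>z. 0 \<le> (f - g) (x - z) \<and> 0 \<le> (h - g) (y - z)"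
      using xf yh graph_of_dual[OF T xf] graph_of_dual[OF T yh] by blast
  qed
qed

theorem theorem4:
  fixes T :: "'a::locally_convex_space \<Rightarrow> ('a \<Rightarrow> real) set"
  assumes T_dual: "\<And>x. T x \<subseteq> topological_dual"
  shows
    "(monotone_operator T \<longleftrightarrow>
      (\<forall>(m::nat) (x :: nat \<Rightarrow> 'a) (f :: nat \<Rightarrow> 'a \<Rightarrow> real).
         m \<ge> 1 \<and> {(x i, f i) | i. i \<in> {1..m}} \<subseteq> graph_of T \<longrightarrow>
         (\<forall>i\<in>{1..m}. \<forall>j\<in>{1..m}. (f i - f j) (x i - x j) \<ge> 0)))
    \<and>
    (monotone_operator T \<longleftrightarrow>
      (\<forall>g\<in>topological_dual. \<forall>(m::nat) (x :: nat \<Rightarrow> 'a) (f :: nat \<Rightarrow> 'a \<Rightarrow> real).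
         m \<ge> 1 \<and> {(x i, f i) | i. i \<in> {1..m}} \<subseteq> graph_of T \<longrightarrow>
         (\<exists>z\<in>closed_convex_hull {x i | i. i \<in> {1..m}}.
            \<forall>i\<in>{1..m}. (f i - g) (x i - z) \<ge> 0)))
    \<and>
    (monotone_operator T \<longleftrightarrow>
      (\<forall>g\<in>topological_dual. \<forall>K :: 'a set. K \<noteq> {} \<and> compact K \<and> convex K \<longrightarrow>
         (\<exists>z\<in>K. \<forall>(y, h)\<in>graph_of T \<inter> (K \<times> topological_dual). (h - g) (y - z) \<ge> 0)))"
  using monotone_operator_iff_families[of T] monotone_operator_iff_finite_solvable[OF T_dual]
    monotone_operator_iff_compact_solvable[OF T_dual]
  by (intro conjI)

end
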